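(* Let $K$ be Chongchitmate and Ng's nondestabilizable Legendrian representative of the knot type $m(10_{161})$, presented as the plat closure described in the context, with Legendrian contact homology differential graded algebra $(\mathscr{A},\partial)$ over $\mathbb{Z}/2$, where $\mathscr{A}=\mathbb{Z}/2\langle x_1,\dots,x_{40}\rangle$ and $\partial$ is the differential listed explicitly in the context. Then the contact homology $\mathrm{CH}(K)=\ker(\partial)/\mathrm{Im}\,\partial$ and the characteristic algebra $C(K)=\mathscr{A}/\langle \mathrm{Im}\,\partial\rangle$ are both nonvanishing, i.e. $\mathrm{CH}(K)\neq 0$ and $C(K)\neq 0$.
   Context: $\mathbb{Z}/2\langle x_1,\dots,x_n\rangle$ denotes the free, noncommutative, unital $\mathbb{Z}/2$-algebra on $x_1,\dots,x_n$. For a Legendrian knot with front diagram $F$, the contact homology DGA over $\mathbb{Z}/2$ is the free noncommutative unital $\mathbb{Z}/2$-algebra generated by the crossings and right cusps of $F$, with the Chekanov--Eliashberg differential $\partial$, which is $\mathbb{Z}/2$-linear with $\partial(1)=0$ and satisfies the Leibniz rule $\partial(vw)=(\partial v)w+v(\partial w)$ and $\partial^2=0$. The contact homology is $\ker(\partial)$ modulo the two-sided ideal of $\ker(\partial)$ generated by $\mathrm{Im}\,\partial$ (which is $\mathrm{Im}\,\partial$ itself). The characteristic algebra is $\mathscr{A}/\langle\mathrm{Im}\,\partial\rangle$, where $\langle\mathrm{Im}\,\partial\rangle$ is the two-sided ideal of $\mathscr{A}$ generated by $\mathrm{Im}\,\partial$ (equivalently by $\partial x_1,\dots,\partial x_{40}$).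 An algebra is nonvanishing (nontrivial) if it is not the zero ring. The knot $K\;(=m(10_{161})$, $m$ standing for mirror$)$: its front diagram is the plat closure, on 10 strands numbered from top to bottom, of the positive braid word (read left to right; the letter $i$ is a crossing of the strands in positions $i$ and $i+1$) $4,5,2,3,4,5,6,7,8,9,1,1,4,5,6,7,8,9,2,3,4,5,6,7,5,6,7,3,4,4,1,2,6,7,8.$ The crossings are labeled $x_1,\dots,x_{35}$ from left to right and the right cusps $x_{36},\dots,x_{40}$ from top to bottom. The differential $\partial$ on $\mathscr{A}=\mathbb{Z}/2\langle x_1,\dots,x_{40}\rangle$ is: $\partial x_i=0$ for $i\in\{1,3,7,9,12,13,14,16,18,25,27,28,30,33,34\}$; $\partial x_2=x_1$; $\partial x_4=x_3x_1$; $\partial x_5=x_3x_2+x_4$; $\partial x_6=x_3$; $\partial x_8=x_7$; $\partial x_{10}=x_9$; $\partial x_{11}=x_3$; $\partial x_{15}=x_{14}$; $\partial x_{17}=x_{16}$; $\partial x_{19}=x_1+x_{12}x_4+x_{12}x_{11}x_1$; $\partial x_{20}=x_2x_{13}+x_{12}x_5x_{13}+x_{12}x_{11}x_2x_{13}+1+x_{12}x_6+x_{12}x_{11}+x_{19}x_{13}$; $\partial x_{21}=x_2x_{14}+x_{12}x_5x_{14}+x_{12}x_{11}x_2x_{14}+x_{12}x_7+x_{19}x_{14}$; $\partial x_{22}=x_2x_{15}+x_{12}x_5x_{15}+x_{12}x_{11}x_2x_{15}+x_{12}x_8+x_{19}x_{15}+x_{21}$; $\partial x_{23}=x_2x_{16}+x_{12}x_5x_{16}+x_{12}x_{11}x_2x_{16}+x_{12}x_9+x_{19}x_{16}$;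 $\partial x_{24}=x_2x_{17}+x_{12}x_5x_{17}+x_{12}x_{11}x_2x_{17}+x_{12}x_{10}+x_{19}x_{17}+x_{23}$; $\partial x_{26}=x_{25}$; $\partial x_{29}=x_{28}x_{25}$; $\partial x_{31}=x_4+x_{11}x_1$; $\partial x_{32}=x_5x_{13}x_{28}+x_{11}x_2x_{13}x_{28}+x_6x_{28}+x_{11}x_{28}+x_5x_{14}+x_{11}x_2x_{14}+x_7+x_{31}x_{13}x_{28}+x_{31}x_{14}$; $\partial x_{35}=x_{33}x_2x_{18}+x_{33}x_{12}x_5x_{18}+x_{33}x_{12}x_{11}x_2x_{18}+x_{33}x_{12}+x_{33}x_{19}x_{18}+x_{34}x_{27}x_2x_{18}+x_{34}x_{27}x_{12}x_5x_{18}+x_{34}x_{27}x_{12}x_{11}x_2x_{18}+x_{34}x_{27}x_{12}+x_{34}x_{27}x_{19}x_{18}$; $\partial x_{36}=x_{13}x_{28}+x_{14}+1$; $\partial x_{37}=x_5x_{13}x_{29}x_{30}+x_{11}x_2x_{13}x_{29}x_{30}+x_6x_{29}x_{30}+x_{11}x_{29}x_{30}+x_5x_{15}x_{25}x_{30}+x_{11}x_2x_{15}x_{25}x_{30}+x_8x_{25}x_{30}+x_5x_{16}x_{30}+x_{11}x_2x_{16}x_{30}+x_9x_{30}+x_5x_{13}+x_{11}x_2x_{13}+x_6+x_{11}+x_{31}x_{13}x_{29}x_{30}+x_{31}x_{15}x_{25}x_{30}+x_{31}x_{16}x_{30}+x_{31}x_{13}+x_{32}x_{25}x_{30}+1$;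 $\partial x_{38}=x_{33}+x_{30}x_{28}x_{26}x_{33}+x_{30}x_{29}x_{33}+x_{30}x_{28}x_{27}+1$; $\partial x_{39}=x_{27}x_2x_{18}+x_{27}x_{12}x_5x_{18}+x_{27}x_{12}x_{11}x_2x_{18}+x_{27}x_{12}+x_{27}x_{19}x_{18}+1$; $\partial x_{40}=x_{33}x_2+x_{33}x_{12}x_5+x_{33}x_{12}x_{11}x_2+x_{33}x_{19}+x_{34}x_{27}x_2+x_{34}x_{27}x_{12}x_5+x_{34}x_{27}x_{12}x_{11}x_2+x_{34}x_{27}x_{19}+1$. *)

theory Defs
  imports
    "HOL-Library.Poly_Mapping"
    "HOL-Library.Z2"
    "HOL-Algebra.QuotRing"
    "HOL-Algebra.Algebraic_Closure_Type"
begin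

section \<open>Free noncommutative algebras over the field with two elements\<close>

text \<open>
  The free unital algebra on a set is the monoid algebra of the free monoid of words.
  The wrapper type around lists carries the \<^class>\<open>monoid_add\<close> instance
  (concatenation, with the empty word as neutral element) from which
  \<^theory>\<open>HOL-Library.Poly_Mapping\<close> derives the convolution product.
\<close>

datatype 'a free_monoid = Word (letters: "'a list")

instantiation free_monoid :: (type) monoid_add
begin

definition zero_free_monoid :: "'a free_monoid"
  where "0 = Word []"

definition plus_free_monoid :: "'a free_monoid \<Rightarrow> 'a free_monoid \<Rightarrow> 'a free_monoid"
  where "v + w = Word (letters v @ letters w)"

instance
  by standard (simp_all add: zero_free_monoid_def plus_free_monoid_def)

end

type_synonym 'a free_alg = "'a free_monoid \<Rightarrow>\<^sub>0 bit"

definition monomial :: "'a list \<Rightarrow> 'a free_alg"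
  where "monomial w = Poly_Mapping.single (Word w) 1"

definition var :: "'a \<Rightarrow> 'a free_alg"
  where "var a = monomial [a]"

section \<open>Derivations of free algebras\<close>

primrec derivation_word :: "('a \<Rightarrow> 'a free_alg) \<Rightarrow> 'a list \<Rightarrow> 'a free_alg"
  where
    "derivation_word d [] = 0"
  | "derivation_word d (a # w) = d a * monomial w + var a * derivation_word d w"

text \<open>
  The linear extension to the whole algebra; scalars are embedded as multiples of the empty word.
  The lemmas below show that this is the derivation with prescribed values on the generators.
\<close>

definition derivation :: "('a \<Rightarrow> 'a free_alg) \<Rightarrow> 'a free_alg \<Rightarrow> 'a free_alg"
  where "derivation d p =
    (\<Sum>w\<in>Poly_Mapping.keys p.
      Poly_Mapping.single 0 (Poly_Mapping.lookup p w) * derivation_word d (letters w))"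

lemma monomial_Nil: "monomial [] = 1"
  by (simp add: monomial_def flip: zero_free_monoid_def)

lemma monomial_append: "monomial (v @ w) = monomial v * monomial w"
  by (simp add: monomial_def mult_single plus_free_monoid_def)

lemma monomial_Cons: "monomial (a # w) = var a * monomial w"
  using monomial_append[of "[a]" w] by (simp add: var_def)

lemma free_alg_add_self [simp]: "p + p = 0" for p :: "'a free_alg"
  by (rule poly_mapping_eqI) (simp add: lookup_add)

lemma free_alg_add_self_left [simp]: "p + (p + q) = q" for p q :: "'a free_alg"
  by (simp flip: add.assoc)

lemma free_alg_uminus [simp]: "- p = p" for p :: "'a free_alg"
  by (rule minus_unique) simp

lemma derivation_superset:
  assumes "finite S" "Poly_Mapping.keys p \<subseteq> S"
  shows "derivation d p =
    (\<Sum>w\<in>S. Poly_Mapping.single 0 (Poly_Mapping.lookup p w) * derivation_word d (letters w))"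
  unfolding derivation_def
  by (rule sum.mono_neutral_left) (use assms in \<open>auto simp: in_keys_iff\<close>)

lemma derivation_add: "derivation d (p + q) = derivation d p + derivation d q"
proof -
  let ?S = "Poly_Mapping.keys p \<union> Poly_Mapping.keys q"
  have "derivation d (p + q) =
      (\<Sum>w\<in>?S. Poly_Mapping.single 0 (Poly_Mapping.lookup (p + q) w) * derivation_word d (letters w))"
    by (rule derivation_superset) (simp_all add: keys_add)
  also have "\<dots> =
      (\<Sum>w\<in>?S. Poly_Mapping.single 0 (Poly_Mapping.lookup p w) * derivation_word d (letters w)) +
      (\<Sum>w\<in>?S. Poly_Mapping.single 0 (Poly_Mapping.lookup q w) * derivation_word d (letters w))"
    by (simp only: lookup_add single_add distrib_right sum.distrib)
  also have "\<dots> = derivation d p + derivation d q"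
    using derivation_superset[of ?S p d] derivation_superset[of ?S q d] by simp
  finally show ?thesis .
qed

lemma derivation_0: "derivation d 0 = 0"
  by (simp add: derivation_def)

lemma derivation_monomial: "derivation d (monomial w) = derivation_word d w"
  by (simp add: derivation_def monomial_def)

lemma derivation_1: "derivation d 1 = 0"
  using derivation_monomial[of d "[]"] by (simp add: monomial_Nil)

lemma derivation_var: "derivation d (var a) = d a"
  by (simp add: var_def derivation_monomial monomial_Nil)

lemma free_alg_induct [case_names zero add]:
  fixes p :: "'a free_alg"
  assumes "P 0" and add: "\<And>w p. P p \<Longrightarrow> P (monomial w + p)"
  shows "P p"
proof (induction "card (Poly_Mapping.keys p)" arbitrary: p)
  case 0
  then show ?case using assms(1) by simp
next
  case (Suc n)
  then obtain v where v: "v \<in> Poly_Mapping.keys p"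
    by (metis card.empty ex_in_conv nat.distinct(1))
  let ?m = "monomial (letters v)"
  have m: "Poly_Mapping.lookup ?m u = (if u = v then 1 else 0)" for u
    by (simp add: monomial_def lookup_single when_def)
  have "Poly_Mapping.keys (?m + p) = Poly_Mapping.keys p - {v}"
    using v by (auto simp: in_keys_iff lookup_add m split: if_splits)
  then have "P (?m + p)"
    using Suc.hyps v by simp
  then show ?case
    using add[of "?m + p" "letters v"] by simp
qed

lemma derivation_word_append:
  "derivation_word d (v @ w) = derivation_word d v * monomial w + monomial v * derivation_word d w"
  by (induction v)
    (simp_all add: monomial_Nil monomial_append monomial_Cons algebra_simps)

lemma derivation_mult: "derivation d (p * q) = derivation d p * q + p * derivation d q"
proof (induction p rule: free_alg_induct)
  case zero
  then show ?case by (simp add: derivation_0)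
next
  case (add v p)
  have "derivation d (monomial v * q) = derivation d (monomial v) * q + monomial v * derivation d q"
  proof (induction q rule: free_alg_induct)
    case zero
    then show ?case by (simp add: derivation_0)
  next
    case (add w q)
    have "derivation d (monomial v * monomial w) =
        derivation d (monomial v) * monomial w + monomial v * derivation d (monomial w)"
      using derivation_word_append[of d v w]
      by (simp add: derivation_monomial flip: monomial_append)
    with add show ?case
      by (simp add: distrib_left derivation_add algebra_simps)
  qed
  with add show ?case
    by (simp add: distrib_right derivation_add algebra_simps)
qed

lemma derivation_derivation_eq_0:
  assumes "\<And>a. derivation d (d a) = 0"
  shows "derivation d (derivation d p) = 0"
proof (induction p rule: free_alg_induct)
  case zero
  then show ?case by (simp add: derivation_0)
next
  case (add w p)
  have "derivation d (derivation d (monomial w)) = 0"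
    by (induction w)
      (simp_all add: monomial_Nil monomial_Cons derivation_1 derivation_0 derivation_mult
        derivation_add derivation_var assms)
  with add show ?case by (simp add: derivation_add)
qed

section \<open>The differential graded algebra of the Legendrian $m(10_{161})$ knot\<close>

text \<open>
  Chongchitmate and Ng's nondestabilizable representative of the mirror of $10_{161}$ has as front
  the plat closure, on 10 strands numbered from the top, of the positive braid word
  4, 5, 2, 3, 4, 5, 6, 7, 8, 9, 1, 1, 4, 5, 6, 7, 8, 9, 2, 3, 4, 5, 6, 7, 5, 6, 7, 3, 4, 4, 1, 2,
  6, 7, 8.
  Generators 1 to 35 are its crossings from left to right, generators 36 to 40 its right cusps from
  top to bottom.  The table is the Chekanov--Eliashberg differential over $\mathbb{Z}/2$ on
  generators, taken as given rather than derived from the front.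
\<close>

typedef generator = "{1..40::nat}"
  by auto

type_synonym dga = "generator free_alg"

definition gen :: "nat \<Rightarrow> dga"
  where "gen i = var (Abs_generator i)"

text \<open>Generators without an entry in the table are cycles.\<close>

definition differential_table :: "(nat \<times> dga) list"
  where "differential_table = [
      (2, gen 1),
      (4, gen 3 * gen 1),
      (5, gen 3 * gen 2 + gen 4),
      (6, gen 3),
      (8, gen 7),
      (10, gen 9),
      (11, gen 3),
      (15, gen 14),
      (17, gen 16),
      (19, gen 1 + gen 12 * gen 4 + gen 12 * gen 11 * gen 1),
      (20, gen 2 * gen 13 + gen 12 * gen 5 * gen 13 + gen 12 * gen 11 * gen 2 * gen 13 + 1 + gen 12 * gen 6 +
           gen 12 * gen 11 + gen 19 * gen 13),
      (21, gen 2 * gen 14 + gen 12 * gen 5 * gen 14 + gen 12 * gen 11 * gen 2 * gen 14 + gen 12 * gen 7 +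
           gen 19 * gen 14),
      (22, gen 2 * gen 15 + gen 12 * gen 5 * gen 15 + gen 12 * gen 11 * gen 2 * gen 15 + gen 12 * gen 8 +
           gen 19 * gen 15 + gen 21),
      (23, gen 2 * gen 16 + gen 12 * gen 5 * gen 16 + gen 12 * gen 11 * gen 2 * gen 16 + gen 12 * gen 9 +
           gen 19 * gen 16),
      (24, gen 2 * gen 17 + gen 12 * gen 5 * gen 17 + gen 12 * gen 11 * gen 2 * gen 17 + gen 12 * gen 10 +
           gen 19 * gen 17 + gen 23),
      (26, gen 25),
      (29, gen 28 * gen 25),
      (31, gen 4 + gen 11 * gen 1),
      (32, gen 5 * gen 13 * gen 28 + gen 11 * gen 2 * gen 13 * gen 28 + gen 6 * gen 28 + gen 11 * gen 28 +
           gen 5 * gen 14 + gen 11 * gen 2 * gen 14 + gen 7 + gen 31 * gen 13 * gen 28 + gen 31 * gen 14),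
      (35, gen 33 * gen 2 * gen 18 + gen 33 * gen 12 * gen 5 * gen 18 + gen 33 * gen 12 * gen 11 * gen 2 * gen 18 +
           gen 33 * gen 12 + gen 33 * gen 19 * gen 18 + gen 34 * gen 27 * gen 2 * gen 18 +
           gen 34 * gen 27 * gen 12 * gen 5 * gen 18 + gen 34 * gen 27 * gen 12 * gen 11 * gen 2 * gen 18 +
           gen 34 * gen 27 * gen 12 + gen 34 * gen 27 * gen 19 * gen 18),
      (36, gen 13 * gen 28 + gen 14 + 1),
      (37, gen 5 * gen 13 * gen 29 * gen 30 + gen 11 * gen 2 * gen 13 * gen 29 * gen 30 + gen 6 * gen 29 * gen 30 +
           gen 11 * gen 29 * gen 30 + gen 5 * gen 15 * gen 25 * gen 30 + gen 11 * gen 2 * gen 15 * gen 25 * gen 30 +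
           gen 8 * gen 25 * gen 30 + gen 5 * gen 16 * gen 30 + gen 11 * gen 2 * gen 16 * gen 30 + gen 9 * gen 30 +
           gen 5 * gen 13 + gen 11 * gen 2 * gen 13 + gen 6 + gen 11 + gen 31 * gen 13 * gen 29 * gen 30 +
           gen 31 * gen 15 * gen 25 * gen 30 + gen 31 * gen 16 * gen 30 + gen 31 * gen 13 +
           gen 32 * gen 25 * gen 30 + 1),
      (38, gen 33 + gen 30 * gen 28 * gen 26 * gen 33 + gen 30 * gen 29 * gen 33 + gen 30 * gen 28 * gen 27 + 1),
      (39, gen 27 * gen 2 * gen 18 + gen 27 * gen 12 * gen 5 * gen 18 + gen 27 * gen 12 * gen 11 * gen 2 * gen 18 +
           gen 27 * gen 12 + gen 27 * gen 19 * gen 18 + 1),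
      (40, gen 33 * gen 2 + gen 33 * gen 12 * gen 5 + gen 33 * gen 12 * gen 11 * gen 2 + gen 33 * gen 19 +
           gen 34 * gen 27 * gen 2 + gen 34 * gen 27 * gen 12 * gen 5 + gen 34 * gen 27 * gen 12 * gen 11 * gen 2 +
           gen 34 * gen 27 * gen 19 + 1)]"

definition differential_generator :: "generator \<Rightarrow> dga"
  where "differential_generator a =
    (case map_of differential_table (Rep_generator a) of None \<Rightarrow> 0 | Some p \<Rightarrow> p)"

definition differential :: "dga \<Rightarrow> dga"
  where "differential = derivation differential_generator"

lemma differential_0: "differential 0 = 0"
  and differential_1: "differential 1 = 0"
  and differential_add: "differential (p + q) = differential p + differential q"
  and differential_mult: "differential (p * q) = differential p * q + p * differential q"
  by (simp_all add: differential_def derivation_0 derivation_1 derivation_add derivation_mult)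

lemma differential_gen:
  assumes "i \<in> {1..40}"
  shows "differential (gen i) = (case map_of differential_table i of None \<Rightarrow> 0 | Some p \<Rightarrow> p)"
  using assms
  by (simp add: differential_def gen_def derivation_var differential_generator_def Abs_generator_inverse)

lemmas differential_gens =
  differential_gen[of 1, unfolded differential_table_def, simplified]
  differential_gen[of 2, unfolded differential_table_def, simplified]
  differential_gen[of 3, unfolded differential_table_def, simplified]
  differential_gen[of 4, unfolded differential_table_def, simplified]
  differential_gen[of 5, unfolded differential_table_def, simplified]
  differential_gen[of 6, unfolded differential_table_def, simplified]
  differential_gen[of 7, unfolded differential_table_def, simplified]
  differential_gen[of 8, unfolded differential_table_def, simplified]
  differential_gen[of 9, unfolded differential_table_def, simplified]
  differential_gen[of 10, unfolded differential_table_def, simplified]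
  differential_gen[of 11, unfolded differential_table_def, simplified]
  differential_gen[of 12, unfolded differential_table_def, simplified]
  differential_gen[of 13, unfolded differential_table_def, simplified]
  differential_gen[of 14, unfolded differential_table_def, simplified]
  differential_gen[of 15, unfolded differential_table_def, simplified]
  differential_gen[of 16, unfolded differential_table_def, simplified]
  differential_gen[of 17, unfolded differential_table_def, simplified]
  differential_gen[of 18, unfolded differential_table_def, simplified]
  differential_gen[of 19, unfolded differential_table_def, simplified]
  differential_gen[of 20, unfolded differential_table_def, simplified]
  differential_gen[of 21, unfolded differential_table_def, simplified]
  differential_gen[of 22, unfolded differential_table_def, simplified]
  differential_gen[of 23, unfolded differential_table_def, simplified]
  differential_gen[of 24, unfolded differential_table_def, simplified]
  differential_gen[of 25, unfolded differential_table_def, simplified]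
  differential_gen[of 26, unfolded differential_table_def, simplified]
  differential_gen[of 27, unfolded differential_table_def, simplified]
  differential_gen[of 28, unfolded differential_table_def, simplified]
  differential_gen[of 29, unfolded differential_table_def, simplified]
  differential_gen[of 30, unfolded differential_table_def, simplified]
  differential_gen[of 31, unfolded differential_table_def, simplified]
  differential_gen[of 32, unfolded differential_table_def, simplified]
  differential_gen[of 33, unfolded differential_table_def, simplified]
  differential_gen[of 34, unfolded differential_table_def, simplified]
  differential_gen[of 35, unfolded differential_table_def, simplified]
  differential_gen[of 36, unfolded differential_table_def, simplified]
  differential_gen[of 37, unfolded differential_table_def, simplified]
  differential_gen[of 38, unfolded differential_table_def, simplified]
  differential_gen[of 39, unfolded differential_table_def, simplified]
  differential_gen[of 40, unfolded differential_table_def, simplified]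

lemma differential_differential_table: "\<forall>(i, p) \<in> set differential_table. differential p = 0"
  by (simp add: differential_table_def differential_gens differential_0 differential_1
      differential_add differential_mult distrib_left distrib_right add_ac mult.assoc)

lemma differential_differential: "differential (differential p) = 0"
  unfolding differential_def
proof (rule derivation_derivation_eq_0)
  fix a
  show "derivation differential_generator (differential_generator a) = 0"
    using differential_differential_table
    by (auto simp: differential_generator_def differential_def derivation_0 dest: map_of_SomeD split: option.split)
qed

section \<open>Contact homology and the characteristic algebra\<close>

definition dga_ring :: "dga ring"
  where "dga_ring = ring_of_type_algebra"

definition cycle_ring :: "dga ring"
  where "cycle_ring = dga_ring\<lparr>carrier := {p. differential p = 0}\<rparr>"

definition contact_homology :: "dga set ring"
  where "contact_homology = cycle_ring Quot (Idl\<^bsub>cycle_ring\<^esub> (range differential))"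

definition characteristic_algebra :: "dga set ring"
  where "characteristic_algebra = dga_ring Quot (Idl\<^bsub>dga_ring\<^esub> (range differential))"

definition nonvanishing :: "('a, 'b) ring_scheme \<Rightarrow> bool"
  where "nonvanishing R \<longleftrightarrow> carrier R \<noteq> {\<zero>\<^bsub>R\<^esub>}"

lemmas dga_ring_defs = dga_ring_def ring_of_type_algebra_def

lemma ring_dga_ring: "ring dga_ring"
proof -
  have "\<exists>q. p + q = 0 \<and> q + p = 0" for p :: dga
    by (rule exI[of _ p]) simp
  then show ?thesis
    by unfold_locales (auto simp: dga_ring_defs algebra_simps Units_def)
qed

lemma ring_cycle_ring: "ring cycle_ring"
proof -
  have "\<exists>q. differential q = 0 \<and> p + q = 0 \<and> q + p = 0" if "differential p = 0" for p
    by (rule exI[of _ p]) (simp add: that)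
  then show ?thesis
    by unfold_locales
      (auto simp: cycle_ring_def dga_ring_defs algebra_simps Units_def
        differential_0 differential_1 differential_add differential_mult)
qed

text \<open>The boundaries already form an ideal of the cycles, so contact homology is
  \<open>ker \<partial> / im \<partial>\<close>.\<close>

lemma ideal_boundaries: "ideal (range differential) cycle_ring"
proof (rule idealI)
  show "ring cycle_ring" by (rule ring_cycle_ring)
  interpret ring cycle_ring by (rule ring_cycle_ring)
  have inv: "inv\<^bsub>add_monoid cycle_ring\<^esub> p = p" if "p \<in> range differential" for p
    using that minus_equality[of p p]
    by (auto simp: cycle_ring_def dga_ring_defs a_inv_def differential_differential)
  have zero: "0 \<in> range differential"
    by (metis differential_0 rangeI)
  show "subgroup (range differential) (add_monoid cycle_ring)"
  proof (rule subgroup.intro)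
    fix p assume "p \<in> range differential"
    with inv show "inv\<^bsub>add_monoid cycle_ring\<^esub> p \<in> range differential"
      by (simp only:)
  qed (auto simp: zero cycle_ring_def dga_ring_defs differential_differential
      simp flip: differential_add)
next
  fix a q assume aq: "a \<in> range differential" "q \<in> carrier cycle_ring"
  then obtain p where p: "a = differential p" by auto
  from aq have "differential q = 0" by (simp add: cycle_ring_def)
  then have "q * a = differential (q * p)" "a * q = differential (p * q)"
    by (simp_all add: p differential_mult)
  then show "q \<otimes>\<^bsub>cycle_ring\<^esub> a \<in> range differential"
    and "a \<otimes>\<^bsub>cycle_ring\<^esub> q \<in> range differential"
    by (simp_all add: cycle_ring_def dga_ring_defs)
qed

lemma contact_homology_eq: "contact_homology = cycle_ring Quot (range differential)"
proof -
  interpret ring cycle_ring by (rule ring_cycle_ring)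
  have "range differential \<subseteq> carrier cycle_ring"
    by (auto simp: cycle_ring_def differential_differential)
  then have "Idl\<^bsub>cycle_ring\<^esub> (range differential) = range differential"
    by (intro equalityI genideal_minimal ideal_boundaries genideal_self subset_refl)
  then show ?thesis by (simp add: contact_homology_def)
qed

end

theory Submission
  imports Defs "HOL-Computational_Algebra.Formal_Power_Series"
begin

text \<open>
  If \<open>1\<close> were a boundary it would lie in the two-sided ideal generated by the boundaries, so both
  claims follow once \<open>1\<close> is kept out of that ideal.  For this it suffices to let the free algebra
  act on a nonzero vector space over \<open>\<int>/2\<close> in such a way that every \<open>\<partial> x\<^sub>i\<close> acts as zero: the
  elements acting as zero form a two-sided ideal, which then contains all boundaries but not \<open>1\<close>.

  To find such a space, eliminate generators in the characteristic algebra.  What remains forces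
  \<open>s = x\<^sub>2\<^sub>8\<close>, \<open>t = x\<^sub>1\<^sub>2\<close>, \<open>u = x\<^sub>1\<^sub>3\<close> and
  \<open>v = x\<^sub>6 + x\<^sub>1\<^sub>1 + (x\<^sub>5 + x\<^sub>1\<^sub>1 x\<^sub>2 + x\<^sub>3\<^sub>1) x\<^sub>1\<^sub>3\<close> to satisfy
  \<open>u s = v t = 1\<close>, \<open>u t = v s = 0\<close> and \<open>s u + t v = 1\<close>, the relations
  of the Leavitt algebra of type \<open>(1,2)\<close>.  A module on which they hold is isomorphic to the direct
  sum of two copies of itself, so the space, being nonzero, must be infinite-dimensional.
  Power series in \<open>z\<close> over
  \<open>\<int>/2\<close> split in this way into their even and odd parts: take \<open>t f = f(z\<^sup>2)\<close> and
  \<open>s f = z f(z\<^sup>2)\<close>, so that \<open>v\<close> and \<open>u\<close> extract the two halves of \<open>f = (v f)(z\<^sup>2) + z (u f)(z\<^sup>2)\<close>.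

  With \<open>x\<^sub>2 = s\<close>, \<open>x\<^sub>6 = x\<^sub>2\<^sub>7 = v\<close>, \<open>x\<^sub>3\<^sub>3 = u\<close> and all generators other than these and \<open>a = x\<^sub>2\<^sub>9\<close>,
  \<open>b = x\<^sub>3\<^sub>0\<close> set to zero, the relations that are left hold as soon as
  \<open>b s = t\<close>, \<open>b a = 1 + s\<close> and \<open>v a b = 1 + v\<close>.
  They are solved by \<open>a f = z\<^sup>2 f(z\<^sup>2)\<close> and \<open>b f = (f + v f)/z\<close>; the division is possible because
  \<open>f\<close> and \<open>v f\<close> have the same constant term.  That every \<open>\<partial> x\<^sub>i\<close> then acts as zero is
  \<open>series_rep_table\<close>, and \<open>rep_derivation_eq_0\<close> passes from the generators to all boundaries.
\<close>

section \<open>Actions of a free algebra\<close>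

text \<open>
  Operators assigned freely to the generators extend to the whole algebra.  The assumption that
  the group has exponent two is what makes the extension additive: coefficients in \<open>\<int>/2\<close> cancel
  in pairs.
\<close>

locale free_alg_action =
  fixes act :: "'a \<Rightarrow> 'v::ab_group_add \<Rightarrow> 'v"
  assumes char_two: "v + v = (0 :: 'v)"
    and act_add: "act a (v + w) = act a v + act a w"
begin

definition rep :: "'a free_alg \<Rightarrow> 'v \<Rightarrow> 'v"
  where "rep p v = (\<Sum>w\<in>Poly_Mapping.keys p. foldr act (letters w) v)"

lemma act_0: "act a 0 = 0"
  using act_add[of a 0 0] by simp

lemma foldr_act_add: "foldr act w (u + v) = foldr act w u + foldr act w v"
  by (induction w) (simp_all add: act_add)

lemma rep_superset:
  assumes "finite S" "Poly_Mapping.keys p \<subseteq> S"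
  shows "rep p v =
    (\<Sum>w\<in>S. if Poly_Mapping.lookup p w = 0 then 0 else foldr act (letters w) v)"
  unfolding rep_def
  by (rule sum.mono_neutral_cong_left) (use assms in \<open>auto simp: in_keys_iff\<close>)

lemma rep_add: "rep (p + q) v = rep p v + rep q v"
proof -
  let ?S = "Poly_Mapping.keys p \<union> Poly_Mapping.keys q"
  have S: "finite ?S" "Poly_Mapping.keys (p + q) \<subseteq> ?S"
    by (simp_all add: keys_add)
  have bit_add_eq_0: "c + d = 0 \<longleftrightarrow> c = d" for c d :: bit
    by (cases c; cases d) simp_all
  show ?thesis
    unfolding rep_superset[OF S] rep_superset[of ?S p, simplified] rep_superset[of ?S q, simplified]
      sum.distrib[symmetric]
    by (rule sum.cong) (auto simp: lookup_add bit_add_eq_0 char_two)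
qed

lemma rep_0: "rep 0 v = 0"
  by (simp add: rep_def)

lemma rep_monomial: "rep (monomial w) v = foldr act w v"
  by (simp add: rep_def monomial_def)

lemma rep_1: "rep 1 v = v"
  using rep_monomial[of "[]"] by (simp add: monomial_Nil)

lemma rep_var: "rep (var a) v = act a v"
  by (simp add: var_def rep_monomial)

lemma rep_add_right: "rep p (v + w) = rep p v + rep p w"
  by (simp add: rep_def foldr_act_add sum.distrib)

lemma rep_0_right: "rep p 0 = 0"
  using rep_add_right[of p 0 0] by simp

lemma rep_mult: "rep (p * q) v = rep p (rep q v)"
proof (induction p rule: free_alg_induct)
  case zero
  then show ?case by (simp add: rep_0)
next
  case (add u p)
  have "rep (monomial u * q) v = foldr act u (rep q v)"
  proof (induction q rule: free_alg_induct)
    case zero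
    then show ?case using rep_0_right[of "monomial u"] by (simp add: rep_0 rep_monomial)
  next
    case (add w q)
    then show ?case
      by (simp add: distrib_left rep_add rep_monomial foldr_act_add flip: monomial_append)
  qed
  with add show ?case
    by (simp add: distrib_right rep_add rep_monomial)
qed

text \<open>The Leibniz rule puts \<open>\<partial> w\<close>, for a word \<open>w\<close>, into the two-sided ideal generated by
  the \<open>\<partial> x\<^sub>i\<close>, so annihilating these is enough to annihilate every boundary.\<close>

lemma rep_derivation_eq_0:
  assumes "\<And>a v. rep (d a) v = 0"
  shows "rep (derivation d p) v = 0"
proof (induction p rule: free_alg_induct)
  case zero
  then show ?case by (simp add: derivation_0 rep_0)
next
  case (add w p)
  have "rep (derivation_word d w) v = 0"
    by (induction w) (simp_all add: rep_0 rep_add rep_mult rep_var assms act_0)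
  with add show ?case
    by (simp add: derivation_add derivation_monomial rep_add)
qed

end

section \<open>Power series as a module over the characteristic algebra\<close>

definition even_half :: "bit fps \<Rightarrow> bit fps"
  where "even_half f = Abs_fps (\<lambda>n. f $ (2 * n))"

definition odd_half :: "bit fps \<Rightarrow> bit fps"
  where "odd_half f = Abs_fps (\<lambda>n. f $ (2 * n + 1))"

definition dilate :: "bit fps \<Rightarrow> bit fps"
  where "dilate f = fps_compose f (fps_X ^ 2)"

definition series_act :: "nat \<Rightarrow> bit fps \<Rightarrow> bit fps"
  where "series_act i f =
    (if i = 12 then dilate f
     else if i \<in> {2, 28} then fps_X * dilate f
     else if i = 29 then fps_X ^ 2 * dilate f
     else if i \<in> {6, 27} then even_half f
     else if i \<in> {13, 33} then odd_half f
     else if i = 30 then fps_shift 1 (f + even_half f)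
     else 0)"

lemma nth_halves [simp]: "even_half f $ n = f $ (2 * n)" "odd_half f $ n = f $ (2 * n + 1)"
  by (simp_all add: even_half_def odd_half_def)

lemma nth_dilate [simp]: "dilate f $ n = (if even n then f $ (n div 2) else 0)"
  by (simp add: dilate_def fps_nth_compose_X_power)

lemma fps_bit_add_self [simp]: "f + f = 0" for f :: "bit fps"
proof (rule fps_ext)
  fix n
  show "(f + f) $ n = 0 $ n"
    unfolding fps_add_nth fps_zero_nth by (cases "f $ n") simp_all
qed

lemma fps_bit_add_self_left [simp]: "f + (f + g) = g" for f g :: "bit fps"
  by (simp flip: add.assoc)

lemma halves_add: "even_half (f + g) = even_half f + even_half g"
    "odd_half (f + g) = odd_half f + odd_half g"
  by (rule fps_ext; simp)+

lemma dilate_add: "dilate (f + g) = dilate f + dilate g"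
  by (simp add: dilate_def fps_compose_add_distrib)

lemma series_act_add: "series_act i (f + g) = series_act i f + series_act i g"
  by (simp add: series_act_def halves_add dilate_add distrib_left fps_shift_add add_ac)

lemma halves_dilate:
  "even_half (dilate f) = f" "odd_half (dilate f) = 0"
  "even_half (fps_X * dilate f) = 0" "odd_half (fps_X * dilate f) = f"
  by (rule fps_ext; simp)+

lemma series_ops_0: "even_half 0 = 0" "odd_half 0 = 0" "dilate 0 = 0"
  by (rule fps_ext; simp)+

text \<open>The relation \<open>s u + t v = 1\<close>; the other relations of the Leavitt algebra are
  \<open>halves_dilate\<close>.\<close>

lemma dilate_halves: "dilate (even_half f) + fps_X * dilate (odd_half f) = f"
  by (rule fps_ext) (auto elim!: evenE oddE)

lemma even_half_double_shift: "even_half (fps_X ^ 2 * dilate f) = fps_X * f"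
proof (rule fps_ext)
  fix n
  show "even_half (fps_X ^ 2 * dilate f) $ n = (fps_X * f) $ n"
    by (cases n) (simp_all add: fps_X_power_mult_nth)
qed

text \<open>Since \<open>v s = 0\<close> and \<open>v a f = z f\<close>, the next two lemmas amount to \<open>b s = t\<close> and
  \<open>b a = 1 + s\<close>, with \<open>a\<close> and \<open>b\<close> as in the introduction.\<close>

lemma shift_fps_X_dilate: "fps_shift (Suc 0) (fps_X * dilate f) = dilate f"
  by (rule fps_ext) simp

lemma shift_fps_X2_dilate:
  "fps_shift (Suc 0) (fps_X * f + fps_X ^ 2 * dilate f) = fps_X * dilate f + f"
proof -
  have "fps_X * f + fps_X ^ 2 * dilate f = fps_X * (fps_X * dilate f + f)"
    by (simp add: power2_eq_square algebra_simps)
  then show ?thesis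
    by (simp only: fps_eq_iff fps_shift_nth fps_X_mult_nth) simp
qed

text \<open>The left-hand side is \<open>v a b f\<close>, so this is \<open>v a b = 1 + v\<close>.\<close>

lemma fps_X_shift_even_half: "fps_X * fps_shift (Suc 0) (f + even_half f) = f + even_half f"
  by (rule fps_ext) simp

interpretation series: free_alg_action "\<lambda>a. series_act (Rep_generator a)"
  by unfold_locales (simp_all add: series_act_add)

lemma series_rep_gen: "i \<in> {1..40} \<Longrightarrow> series.rep (gen i) f = series_act i f"
  by (simp add: gen_def series.rep_var Abs_generator_inverse)

text \<open>All terms of \<open>\<partial> x\<^sub>i\<close> contain a generator acting as zero unless \<open>i\<close> is \<open>20\<close>, \<open>32\<close> or at
  least \<open>35\<close>.  Of the values that remain, those for \<open>32\<close>, \<open>35\<close>, \<open>36\<close>, \<open>39\<close> and \<open>40\<close> reduce to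
  \<open>v s = u t = 0\<close> and \<open>u s = v t = 1\<close>, the one for \<open>20\<close> is \<open>s u + t v + 1\<close>, the one for \<open>37\<close> is
  \<open>v a b + v + 1\<close>, and the one for \<open>38\<close> is \<open>(1 + b a) u + b s v + 1 = s u + t v + 1\<close>.\<close>

lemma series_rep_table: "\<forall>(i, p) \<in> set differential_table. \<forall>f. series.rep p f = 0"
  by (simp add: differential_table_def series.rep_add series.rep_mult series.rep_1 series_rep_gen
      series_act_def series_ops_0 halves_dilate dilate_halves even_half_double_shift shift_fps_X_dilate
      shift_fps_X2_dilate fps_X_shift_even_half add_ac)

lemma series_rep_differential: "series.rep (differential p) f = 0"
  unfolding differential_def
proof (rule series.rep_derivation_eq_0)
  fix a g
  show "series.rep (differential_generator a) g = 0"
    using series_rep_table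
    by (auto simp: differential_generator_def series.rep_0 dest: map_of_SomeD split: option.split)
qed

section \<open>Nonvanishing of the quotients\<close>

lemma nonvanishing_Quot:
  assumes "ideal I R" "\<one>\<^bsub>R\<^esub> \<notin> I"
  shows "nonvanishing (R Quot I)"
proof -
  interpret ideal I R by fact
  have "I +>\<^bsub>R\<^esub> \<one>\<^bsub>R\<^esub> \<in> a_rcosets\<^bsub>R\<^esub> I" "I +>\<^bsub>R\<^esub> \<one>\<^bsub>R\<^esub> \<noteq> I"
    using a_rcosetsI[OF a_subset] rcos_const_imp_mem[of "\<one>\<^bsub>R\<^esub>"] assms(2) by auto
  then show ?thesis
    by (auto simp: nonvanishing_def FactRing_def)
qed

lemma ideal_series_annihilator: "ideal {p. \<forall>f. series.rep p f = 0} dga_ring"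
proof (rule idealI)
  show "ring dga_ring" by (rule ring_dga_ring)
  interpret ring dga_ring by (rule ring_dga_ring)
  have inv: "inv\<^bsub>add_monoid dga_ring\<^esub> p = p" for p
    using minus_equality[of p p] by (simp add: dga_ring_defs a_inv_def)
  show "subgroup {p. \<forall>f. series.rep p f = 0} (add_monoid dga_ring)"
    by (rule subgroup.intro) (simp_all only: inv, auto simp: dga_ring_defs series.rep_0 series.rep_add)
qed (auto simp: dga_ring_defs series.rep_mult series.rep_0_right)

theorem theorem1:
  shows "nonvanishing contact_homology \<and> nonvanishing characteristic_algebra"
proof
  have "series.rep 1 1 \<noteq> 0"
    by (simp add: series.rep_1)
  then have "1 \<notin> range differential"
    using series_rep_differential by (metis imageE)
  then show "nonvanishing contact_homology"
    unfolding contact_homology_eq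
    by (intro nonvanishing_Quot ideal_boundaries) (simp add: cycle_ring_def dga_ring_defs)
next
  interpret ring dga_ring by (rule ring_dga_ring)
  have "Idl\<^bsub>dga_ring\<^esub> (range differential) \<subseteq> {p. \<forall>f. series.rep p f = 0}"
    by (rule genideal_minimal[OF ideal_series_annihilator]) (auto simp: series_rep_differential)
  moreover have "series.rep 1 1 \<noteq> 0"
    by (simp add: series.rep_1)
  ultimately have "1 \<notin> Idl\<^bsub>dga_ring\<^esub> (range differential)"
    by blast
  moreover have "ideal (Idl\<^bsub>dga_ring\<^esub> (range differential)) dga_ring"
    by (rule genideal_ideal) (simp add: dga_ring_defs)
  ultimately show "nonvanishing characteristic_algebra"
    unfolding characteristic_algebra_def
    by (intro nonvanishing_Quot) (simp_all add: dga_ring_defs)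
qed

end
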